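(* Let $\tilde{x}_k$ be the $k$-th iterate of the randomized Kaczmarz (RK) method applied to the doubly noisy linear system $\widetilde{A}x=\tilde{b}$. Let $x_{LS}=A^{\dagger}b$ and $\tilde{x}_{LS}=\widetilde{A}^{\dagger}\tilde{b}$ denote the least-squares solutions of the noiseless linear system $Ax=b$ and the doubly noisy linear system $\widetilde{A}x=\tilde{b}$, respectively. Let $e_k=\tilde{x}_k-x_{LS}$. Then: (i) If $e_{k-1}\in\mathcal{R}(\widetilde{A}^{\top})$, then $$\mathbb{E}\|e_k\|_2^2\le\left(1-\frac{\sigma_{\min}^2(\widetilde{A})}{\|\widetilde{A}\|_F^2}\right)\mathbb{E}\|e_{k-1}\|_2^2+\frac{\|\widetilde{A}x_{LS}-\tilde{b}\|_2^2}{\|\widetilde{A}\|_F^2}.$$ (ii) If $e_{k-1}\in\mathcal{N}(\widetilde{A})$, then $$\mathbb{E}\|e_k\|_2^2=\mathbb{E}\|e_{k-1}\|_2^2+\frac{\|\widetilde{A}x_{LS}-\tilde{b}\|_2^2}{\|\widetilde{A}\|_F^2}$$ when the index $i_k$ is randomly selected such that $\tilde{a}_{i_k}^{\top}x_{LS}-\tilde{b}_{i_k}\neq 0$, and $\tilde{x}_k=\tilde{x}_{k-1}$ if $\tilde{a}_{i_k}^{\top}x_{LS}-\tilde{b}_{i_k}=0$. (iii) If $e_{k-1}\notin\mathcal{R}(\widetilde{A}^{\top})$ and $e_{k-1}\notin\mathcal{N}(\widetilde{A})$, then $$\mathbb{E}\|e_k\|_2^2\le\left(1-\frac{\sigma_{\min}^2(\widetilde{A})}{\|\widetilde{A}\|_F^2}\cdot\xi_{k-1}\right)\mathbb{E}\|e_{k-1}\|_2^2+\frac{\|\widetilde{A}x_{LS}-\tilde{b}\|_2^2}{\|\widetilde{A}\|_F^2},$$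 where $$\xi_{k-1}=\frac{\mathbb{E}\left\|(\tilde{x}_{k-1}-x_{LS})_{\mathcal{R}(\widetilde{A}^{\top})}\right\|_2^2}{\mathbb{E}\left\|\tilde{x}_{k-1}-x_{LS}\right\|_2^2}<1.$$
   Context: $A,\widetilde{A}\in\mathbb{R}^{m\times n}$ and $b,\tilde{b}\in\mathbb{R}^m$, where $\widetilde{A}$ and $\tilde{b}$ are noisy versions of $A$ and $b$. Neither the noiseless system $Ax=b$ nor the doubly noisy system $\widetilde{A}x=\tilde{b}$ is required to be consistent. $M^{\dagger}$ is the Moore-Penrose inverse of $M$, $\mathcal{R}(\cdot)$ and $\mathcal{N}(\cdot)$ denote range and null space, $\|\cdot\|_F$ is the Frobenius norm, $\sigma_{\min}(\widetilde{A})$ is the smallest nonzero singular value of $\widetilde{A}$, and $(x)_{V}$ is the orthogonal projection of $x$ onto the subspace $V$. RK method: let $\tilde{a}_i^{\top}$ be the $i$-th row of $\widetilde{A}$ and $\tilde{b}_i$ the $i$-th entry of $\tilde{b}$. Starting from an initial point $\tilde{x}_0\in\mathbb{R}^n$, at step $k=1,2,\dots$ a row index $i_k\in\{1,\dots,m\}$ is selected at random, index $i$ being chosen with probability $\|\tilde{a}_i\|_2^2/\|\widetilde{A}\|_F^2$, and $$\tilde{x}_k=\tilde{x}_{k-1}-\frac{\tilde{a}_{i_k}^{\top}\tilde{x}_{k-1}-\tilde{b}_{i_k}}{\|\tilde{a}_{i_k}\|_2^2}\,\tilde{a}_{i_k}.$$ $\mathbb{E}$ denotes expectation over the random index choices.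
   Formalization: In (ii) the equality is proved assuming that every zero row of Ã has zero entry in b̃; otherwise it is false, since that row's residual counts in ‖Ãx_LS − b̃‖ but the row is never selected (e.g. Ã=diag(1,0), b̃=(1,1), x_LS=x̃_0=0). *)

theory Defs
  imports "HOL-Analysis.Analysis" "HOL-Probability.Probability"
begin

text \<open>The Moore--Penrose inverse, characterised by the four Penrose equations
  (which have exactly one solution for every real matrix).\<close>

definition is_pseudoinverse :: "real ^ 'n ^ 'm \<Rightarrow> real ^ 'm ^ 'n \<Rightarrow> bool" where
  "is_pseudoinverse A X \<longleftrightarrow>
     A ** X ** A = A \<and> X ** A ** X = X \<and>
     transpose (A ** X) = A ** X \<and> transpose (X ** A) = X ** A"

definition pseudoinverse :: "real ^ 'n ^ 'm \<Rightarrow> real ^ 'm ^ 'n" where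
  "pseudoinverse A = (THE X. is_pseudoinverse A X)"

definition matrix_range :: "real ^ 'n ^ 'm \<Rightarrow> (real ^ 'm) set" where
  "matrix_range A = range (\<lambda>x. A *v x)"

definition matrix_null :: "real ^ 'n ^ 'm \<Rightarrow> (real ^ 'n) set" where
  "matrix_null A = {x. A *v x = 0}"

definition frobenius_norm :: "real ^ 'n ^ 'm \<Rightarrow> real" where
  "frobenius_norm A = sqrt (\<Sum>i\<in>UNIV. \<Sum>j\<in>UNIV. (A $ i $ j)\<^sup>2)"

text \<open>Singular values are the nonnegative square roots of the eigenvalues of \<open>A\<^sup>T A\<close>.
  If \<open>A\<close> has more columns than rows, this set may contain an additional zero compared with
  other conventions; the nonzero singular values are the same.\<close>

definition singular_values :: "real ^ 'n ^ 'm \<Rightarrow> real set" where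
  "singular_values A =
     {s. 0 \<le> s \<and> (\<exists>v. v \<noteq> 0 \<and> (transpose A ** A) *v v = s\<^sup>2 *\<^sub>R v)}"

text \<open>The smallest nonzero singular value; it exists whenever \<open>A \<noteq> 0\<close>.\<close>

definition sigma_min :: "real ^ 'n ^ 'm \<Rightarrow> real" where
  "sigma_min A = (LEAST s. s \<in> singular_values A \<and> s \<noteq> 0)"

text \<open>Orthogonal projection of \<open>x\<close> onto the linear subspace \<open>V\<close>.\<close>

definition orth_proj :: "('a :: euclidean_space) set \<Rightarrow> 'a \<Rightarrow> 'a" where
  "orth_proj V x = (THE p. p \<in> V \<and> (\<forall>v\<in>V. orthogonal (x - p) v))"

text \<open>The iterates for a given sequence of row indices; the entry \<open>idx k\<close> is the row used in
  step \<open>k \<ge> 1\<close>, so \<open>idx 0\<close> is never used.\<close>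

primrec rk_iterate ::
  "real ^ 'n ^ 'm \<Rightarrow> real ^ 'm \<Rightarrow> real ^ 'n \<Rightarrow> (nat \<Rightarrow> 'm) \<Rightarrow> nat \<Rightarrow> real ^ 'n" where
  "rk_iterate A b x0 idx 0 = x0"
| "rk_iterate A b x0 idx (Suc k) =
     (let x = rk_iterate A b x0 idx k; i = idx (Suc k)
      in x - ((row i A \<bullet> x - b $ i) / (norm (row i A))\<^sup>2) *\<^sub>R row i A)"

text \<open>The random row choices: independent over the steps \<open>k \<ge> 1\<close>, row \<open>i\<close> being drawn with
  probability proportional to its squared norm.  Since probabilities add up to one, this is only
  satisfiable for \<open>A \<noteq> 0\<close>.  Zero rows are allowed but are drawn with probability zero.\<close>

definition rk_sampling :: "'w measure \<Rightarrow> real ^ 'n ^ 'm \<Rightarrow> (nat \<Rightarrow> 'w \<Rightarrow> 'm) \<Rightarrow> bool" where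
  "rk_sampling M A idx \<longleftrightarrow>
     prob_space M \<and>
     prob_space.indep_vars M (\<lambda>_. count_space UNIV) idx {1..} \<and>
     (\<forall>k\<ge>1. \<forall>i. measure M {\<omega> \<in> space M. idx k \<omega> = i} =
                   (norm (row i A))\<^sup>2 / (frobenius_norm A)\<^sup>2)"

end

theory Submission
  imports Defs
begin

text \<open>
  Write \<open>e = x - x\<^sub>L\<^sub>S\<close> for the error before a step and \<open>r\<^sub>i = a\<^sub>i \<bullet> x\<^sub>L\<^sub>S - b\<^sub>i\<close> for the
  residual of the reference point in row \<open>i\<close>.  A step that uses row \<open>i\<close> projects onto the hyperplane
  \<open>a\<^sub>i \<bullet> y = b\<^sub>i\<close>, which lies at signed distance \<open>r\<^sub>i / \<parallel>a\<^sub>i\<parallel>\<close> from \<open>x\<^sub>L\<^sub>S\<close>.  Pythagoras therefore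
  says that the step removes the component of \<open>e\<close> along \<open>a\<^sub>i\<close> and puts that distance in its place:
  \<open>\<parallel>e'\<parallel>\<^sup>2 = \<parallel>e\<parallel>\<^sup>2 + (r\<^sub>i\<^sup>2 - (a\<^sub>i \<bullet> e)\<^sup>2) / \<parallel>a\<^sub>i\<parallel>\<^sup>2\<close> (\<open>kaczmarz_step_error\<close>).

  The row of step \<open>k\<close> is independent of \<open>e\<close>, which depends on the earlier rows only, and row \<open>i\<close> is
  drawn with probability \<open>\<parallel>a\<^sub>i\<parallel>\<^sup>2 / \<parallel>A\<parallel>\<^sub>F\<^sup>2\<close>.  The weights cancel the denominators, so on average the
  squared error changes by \<open>(\<Sum>\<^sub>i r\<^sub>i\<^sup>2 - \<parallel>A e\<parallel>\<^sup>2) / \<parallel>A\<parallel>\<^sub>F\<^sup>2\<close>, except that zero rows, which are never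
  drawn, contribute nothing (\<open>rk_expected_error\<close>).  The three claims differ only in what is known
  about \<open>\<parallel>A e\<parallel>\<^sup>2\<close>: it vanishes on the null space, and \<open>\<parallel>A e\<parallel> = \<parallel>A p\<parallel> \<ge> \<sigma>\<^sub>m\<^sub>i\<^sub>n \<parallel>p\<parallel>\<close> for the projection
  \<open>p\<close> of \<open>e\<close> onto the row space (\<open>norm_matrix_ge_sigma_min_orth_proj\<close>).  If \<open>e\<close> is in the row space
  then \<open>p = e\<close>; otherwise averaging \<open>\<parallel>p\<parallel>\<^sup>2\<close> produces the factor \<open>\<xi>\<close>, and \<open>\<xi> < 1\<close> because \<open>p\<close> is
  strictly shorter than \<open>e\<close> with positive probability.
\<close>

section \<open>Orthogonal projection and the smallest nonzero singular value\<close>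

lemma orth_proj_characterization:
  assumes "subspace V"
  shows "orth_proj V x \<in> V" and "\<And>v. v \<in> V \<Longrightarrow> (x - orth_proj V x) \<bullet> v = 0"
proof -
  obtain y z where yz: "y \<in> span V" "\<And>w. w \<in> span V \<Longrightarrow> orthogonal z w" "x = y + z"
    using orthogonal_subspace_decomp_exists[of V x] by metis
  have y: "y \<in> V" using yz(1) span_minimal[OF subset_refl assms] by blast
  have orth: "\<forall>v\<in>V. orthogonal (x - y) v" using yz(2,3) by (simp add: span_base)
  have uniq: "q = y" if "q \<in> V" "\<forall>v\<in>V. orthogonal (x - q) v" for q
  proof -
    have "q - y \<in> V" using that(1) y assms by (simp add: subspace_diff)
    then have "(x - y) \<bullet> (q - y) = 0" "(x - q) \<bullet> (q - y) = 0"
      using that(2) orth by (auto simp: orthogonal_def)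
    then have "(q - y) \<bullet> (q - y) = 0" by (simp add: inner_diff_left inner_diff_right)
    then show ?thesis by simp
  qed
  have "orth_proj V x = y"
    unfolding orth_proj_def using y orth uniq by (intro the_equality) blast+
  then show "orth_proj V x \<in> V" and "\<And>v. v \<in> V \<Longrightarrow> (x - orth_proj V x) \<bullet> v = 0"
    using y orth by (auto simp: orthogonal_def)
qed

lemma norm_orth_proj_pythagoras:
  assumes "subspace V"
  shows "(norm x)\<^sup>2 = (norm (orth_proj V x))\<^sup>2 + (norm (x - orth_proj V x))\<^sup>2"
proof -
  have "(x - orth_proj V x) \<bullet> orth_proj V x = 0"
    using orth_proj_characterization[OF assms] by blast
  then show ?thesis
    unfolding power2_norm_eq_inner by (simp add: inner_diff_left inner_diff_right inner_commute)
qed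

lemma orth_proj_of_mem:
  assumes "subspace V" "x \<in> V"
  shows "orth_proj V x = x"
proof -
  have "x - orth_proj V x \<in> V"
    using assms orth_proj_characterization(1) by (metis subspace_diff)
  then have "(x - orth_proj V x) \<bullet> (x - orth_proj V x) = 0"
    using orth_proj_characterization(2)[OF assms(1)] by blast
  then show ?thesis by simp
qed

lemma inner_transpose_matrix:
  fixes B :: "real ^ 'n ^ 'm"
  shows "(transpose B *v y) \<bullet> w = y \<bullet> (B *v w)"
  by (simp add: dot_lmul_matrix transpose_matrix_vector)

lemma subspace_matrix_range: "subspace (matrix_range B)"
  unfolding matrix_range_def
  by (rule linear_subspace_image[OF matrix_vector_mul_linear subspace_UNIV])

text \<open>A vector orthogonal to all rows of \<open>B\<close> is sent to zero by \<open>B\<close>, so \<open>B\<close> sees only the component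
  in the row space.\<close>

lemma matrix_mult_orth_proj:
  fixes B :: "real ^ 'n ^ 'm"
  shows "B *v orth_proj (matrix_range (transpose B)) x = B *v x"
proof -
  define d where "d = x - orth_proj (matrix_range (transpose B)) x"
  have "d \<bullet> (transpose B *v (B *v d)) = 0"
    unfolding d_def
    by (rule orth_proj_characterization(2)[OF subspace_matrix_range]) (simp add: matrix_range_def)
  then have "(B *v d) \<bullet> (B *v d) = 0"
    by (metis inner_transpose_matrix inner_commute)
  then show ?thesis by (simp add: d_def matrix_vector_mult_diff_distrib)
qed

text \<open>A quadratic polynomial that is nonnegative and vanishes at the origin has no linear term:
  this is the first-order condition at a minimiser.\<close>

lemma linear_coeff_zero_of_nonneg_quadratic:
  fixes p q :: real
  assumes "\<And>t. 0 \<le> 2 * t * p + t\<^sup>2 * q"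
  shows "p = 0"
proof (rule ccontr)
  assume "p \<noteq> 0"
  define t where "t = - p / (\<bar>q\<bar> + 1)"
  have pos: "\<bar>q\<bar> + 1 > 0" by simp
  have "t\<^sup>2 * q \<le> t\<^sup>2 * (\<bar>q\<bar> + 1)" by (intro mult_left_mono) auto
  also have "\<dots> = - (t * p)"
    using pos by (simp add: t_def power2_eq_square divide_simps)
  finally have "2 * t * p + t\<^sup>2 * q \<le> t * p" by linarith
  also have "\<dots> = - (p\<^sup>2 / (\<bar>q\<bar> + 1))" by (simp add: t_def power2_eq_square)
  also have "\<dots> < 0" using \<open>p \<noteq> 0\<close> pos by simp
  finally show False using assms[of t] by simp
qed

text \<open>For \<open>B \<noteq> 0\<close> the square of the smallest nonzero singular value is the minimum of \<open>\<parallel>B v\<parallel>\<^sup>2\<close> over unit vectors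
  \<open>v\<close> of the row space.  A minimiser exists by compactness and is an eigenvector of \<open>B\<^sup>T B\<close> by the
  first-order condition; conversely, every eigenvector of \<open>B\<^sup>T B\<close> with nonzero eigenvalue lies in the
  row space, so no smaller nonzero singular value exists.\<close>

lemma sigma_min_bound:
  fixes B :: "real ^ 'n ^ 'm"
  assumes e: "e \<in> matrix_range (transpose B)"
  shows "(sigma_min B)\<^sup>2 * (norm e)\<^sup>2 \<le> (norm (B *v e))\<^sup>2"
proof (cases "e = 0")
  case True
  then show ?thesis by simp
next
  case False
  define V where "V = matrix_range (transpose B)"
  have V: "subspace V" unfolding V_def by (rule subspace_matrix_range)
  have adj: "(B *v u) \<bullet> (B *v w) = (transpose B *v (B *v u)) \<bullet> w" for u w
    by (rule inner_transpose_matrix[symmetric])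
  have "compact (sphere 0 1 \<inter> V)"
    using closed_subspace[OF V] by (intro compact_Int_closed) auto
  moreover have "(1 / norm e) *\<^sub>R e \<in> sphere 0 1 \<inter> V"
    using e False V by (simp add: V_def subspace_scale)
  then have "sphere 0 1 \<inter> V \<noteq> {}" by blast
  moreover have "continuous_on (sphere 0 1 \<inter> V) (\<lambda>v. (norm (B *v v))\<^sup>2)"
    by (intro continuous_intros linear_continuous_on) (simp add: linear_linear)
  ultimately obtain v where v: "v \<in> sphere 0 1 \<inter> V"
    and vmin: "\<And>u. u \<in> sphere 0 1 \<inter> V \<Longrightarrow> (norm (B *v v))\<^sup>2 \<le> (norm (B *v u))\<^sup>2"
    using continuous_attains_inf by metis
  define c where "c = (norm (B *v v))\<^sup>2"
  have vV: "v \<in> V" and nv: "norm v = 1" using v by auto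
  have cmin: "c * (norm u)\<^sup>2 \<le> (norm (B *v u))\<^sup>2" if "u \<in> V" for u
  proof (cases "u = 0")
    case True
    then show ?thesis by simp
  next
    case False
    have "c \<le> (norm (B *v ((1 / norm u) *\<^sub>R u)))\<^sup>2"
      unfolding c_def using that False V by (intro vmin) (simp add: subspace_scale)
    also have "\<dots> = (norm (B *v u))\<^sup>2 / (norm u)\<^sup>2"
      by (simp add: matrix_vector_mult_scaleR power_divide)
    finally show ?thesis using False by (simp add: pos_le_divide_eq)
  qed
  have eigen: "(transpose B ** B) *v v = c *\<^sub>R v"
  proof -
    \<comment> \<open>Perturbing the minimiser in the direction of its own eigenvector defect \<open>g\<close>, which stays in
      \<open>V\<close>, makes \<open>\<parallel>g\<parallel>\<^sup>2\<close> the linear coefficient.\<close>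
    define g where "g = transpose B *v (B *v v) - c *\<^sub>R v"
    have gV: "g \<in> V" unfolding g_def using vV V
      by (intro subspace_diff subspace_scale) (auto simp: V_def matrix_range_def)
    have "0 \<le> 2 * t * (g \<bullet> g) + t\<^sup>2 * ((norm (B *v g))\<^sup>2 - c * (norm g)\<^sup>2)" for t
    proof -
      have "v + t *\<^sub>R g \<in> V" using vV gV V by (intro subspace_add subspace_scale)
      from cmin[OF this]
      have "c * (norm (v + t *\<^sub>R g))\<^sup>2 \<le> (norm (B *v v + t *\<^sub>R (B *v g)))\<^sup>2"
        by (simp add: matrix_vector_right_distrib matrix_vector_mult_scaleR)
      moreover have "(norm (B *v v + t *\<^sub>R (B *v g)))\<^sup>2
          = c + 2 * t * ((B *v v) \<bullet> (B *v g)) + t\<^sup>2 * (norm (B *v g))\<^sup>2"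
        unfolding c_def power2_norm_eq_inner
        by (simp add: inner_add_left inner_add_right inner_commute power2_eq_square algebra_simps)
      moreover have "(norm (v + t *\<^sub>R g))\<^sup>2 = 1 + 2 * t * (v \<bullet> g) + t\<^sup>2 * (norm g)\<^sup>2"
      proof -
        have "v \<bullet> v = 1" using nv by (simp add: norm_eq_1)
        then show ?thesis unfolding power2_norm_eq_inner
          by (simp add: inner_add_left inner_add_right inner_commute power2_eq_square algebra_simps)
      qed
      moreover have gg: "g \<bullet> g = (B *v v) \<bullet> (B *v g) - c * (v \<bullet> g)"
        unfolding adj by (subst (1) g_def) (simp add: inner_diff_left)
      ultimately show ?thesis unfolding gg by (simp add: algebra_simps)
    qed
    then have "g \<bullet> g = 0" by (rule linear_coeff_zero_of_nonneg_quadratic)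
    then show ?thesis by (simp add: g_def matrix_vector_mul_assoc)
  qed
  have c0: "c \<noteq> 0"
  proof
    assume "c = 0"
    then have "B *v v = 0" by (simp add: c_def)
    obtain y where y: "v = transpose B *v y" using vV by (auto simp: V_def matrix_range_def)
    have "v \<bullet> v = y \<bullet> (B *v v)"
      by (subst (1) y) (rule inner_transpose_matrix)
    then show False using \<open>B *v v = 0\<close> nv by auto
  qed
  have "sigma_min B = sqrt c"
    unfolding sigma_min_def
  proof (rule Least_equality)
    show "sqrt c \<in> singular_values B \<and> sqrt c \<noteq> 0"
      using eigen c0 nv by (auto simp: singular_values_def c_def intro!: exI[of _ v])
  next
    fix s assume s: "s \<in> singular_values B \<and> s \<noteq> 0"
    then obtain w where w: "w \<noteq> 0" "(transpose B ** B) *v w = s\<^sup>2 *\<^sub>R w" and s0: "0 \<le> s"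
      by (auto simp: singular_values_def)
    have eig: "transpose B *v (B *v w) = s\<^sup>2 *\<^sub>R w" using w by (simp add: matrix_vector_mul_assoc)
    then have "w = (1 / s\<^sup>2) *\<^sub>R (transpose B *v (B *v w))" using s by simp
    also have "\<dots> \<in> V" by (intro subspace_scale V) (auto simp: V_def matrix_range_def)
    finally have "c * (norm w)\<^sup>2 \<le> (norm (B *v w))\<^sup>2" by (rule cmin)
    also have "\<dots> = s\<^sup>2 * (norm w)\<^sup>2"
      unfolding power2_norm_eq_inner adj eig by simp
    finally have "c \<le> s\<^sup>2" using w(1) by simp
    then show "sqrt c \<le> s" using s0 by (simp add: real_le_lsqrt c_def)
  qed
  then show ?thesis using cmin[of e] e by (simp add: V_def c_def)
qed

lemma norm_matrix_ge_sigma_min_orth_proj: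
  fixes B :: "real ^ 'n ^ 'm"
  shows "(sigma_min B)\<^sup>2 * (norm (orth_proj (matrix_range (transpose B)) x))\<^sup>2 \<le> (norm (B *v x))\<^sup>2"
  using sigma_min_bound[OF orth_proj_characterization(1)[OF subspace_matrix_range], of B x]
  by (simp add: matrix_mult_orth_proj)

section \<open>A single Kaczmarz step\<close>

text \<open>For \<open>a = 0\<close> no step is taken, and the identity survives because division by zero yields zero
  on both sides.\<close>

lemma kaczmarz_step_error:
  fixes a x z :: "'a :: real_inner"
  shows "(norm (x - ((a \<bullet> x - \<beta>) / (norm a)\<^sup>2) *\<^sub>R a - z))\<^sup>2
       = (norm (x - z))\<^sup>2 + ((a \<bullet> z - \<beta>)\<^sup>2 - (a \<bullet> (x - z))\<^sup>2) / (norm a)\<^sup>2"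
proof (cases "a = 0")
  case True
  then show ?thesis by simp
next
  case False
  define c where "c = (a \<bullet> x - \<beta>) / (norm a)\<^sup>2"
  have c: "c * (a \<bullet> a) = a \<bullet> x - \<beta>" using False by (simp add: c_def power2_norm_eq_inner)
  have "(norm (x - c *\<^sub>R a - z))\<^sup>2 = (norm ((x - z) - c *\<^sub>R a))\<^sup>2" by (simp add: algebra_simps)
  also have "\<dots> = (norm (x - z))\<^sup>2 - 2 * c * (a \<bullet> (x - z)) + c * (c * (a \<bullet> a))"
    unfolding power2_norm_eq_inner
    by (simp add: inner_diff_left inner_diff_right inner_commute algebra_simps)
  also have "\<dots> = (norm (x - z))\<^sup>2 + ((a \<bullet> z - \<beta>)\<^sup>2 - (a \<bullet> (x - z))\<^sup>2) / (norm a)\<^sup>2"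
    unfolding c using False
    by (simp add: c_def field_simps inner_diff_right power2_eq_square)
  finally show ?thesis by (simp add: c_def)
qed

lemma sum_row_inner_squared:
  fixes B :: "real ^ 'n ^ 'm"
  shows "(\<Sum>i\<in>UNIV. (row i B \<bullet> v)\<^sup>2) = (norm (B *v v))\<^sup>2"
  unfolding power2_norm_eq_inner inner_vec_def[of "B *v v"]
  by (simp add: matrix_vector_mul_component row_def power2_eq_square vec_lambda_eta)

section \<open>Averaging over the random row\<close>

lemma rk_iterate_cong:
  assumes "\<And>l. 1 \<le> l \<Longrightarrow> l \<le> j \<Longrightarrow> f l = g l"
  shows "rk_iterate B \<beta> x0 f j = rk_iterate B \<beta> x0 g j"
  using assms by (induction j) (auto simp: Let_def)

text \<open>The underlying space is kept arbitrary, so that the statement applies both to the given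
  probability space and to the product space of the first \<open>j\<close> row choices.\<close>

lemma simple_function_rk_iterate:
  fixes B :: "real ^ 'n ^ 'm"
  assumes "\<And>l. 1 \<le> l \<Longrightarrow> l \<le> j \<Longrightarrow> Y l \<in> measurable N (count_space UNIV)"
  shows "simple_function N (\<lambda>\<omega>. rk_iterate B \<beta> x0 (\<lambda>l. Y l \<omega>) j)"
  using assms
proof (induction j)
  case 0
  then show ?case by simp
next
  case (Suc j)
  have "simple_function N (Y (Suc j))"
    unfolding simple_function_def
    using Suc.prems[of "Suc j"] by (auto intro!: measurable_sets)
  from simple_function_compose2[OF Suc.IH this,
      of "\<lambda>x i. x - ((row i B \<bullet> x - \<beta> $ i) / (norm (row i B))\<^sup>2) *\<^sub>R row i B"]
  show ?case using Suc.prems by (simp add: Let_def)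
qed

lemma (in prob_space) integrable_simple_function_compose:
  fixes g :: "'b \<Rightarrow> real"
  assumes "simple_function M f"
  shows "integrable M (\<lambda>\<omega>. g (f \<omega>))"
proof -
  have fin: "finite (f ` space M)" using assms by (simp add: simple_function_def)
  have "simple_function M (\<lambda>\<omega>. g (f \<omega>))" using assms by (rule simple_function_compose1)
  then have "(\<lambda>\<omega>. g (f \<omega>)) \<in> borel_measurable M" by (rule borel_measurable_simple_function)
  then show ?thesis
    using fin
    by (intro integrable_const_bound[of _ "Max ((\<lambda>y. norm (g y)) ` f ` space M)"])
      (auto intro!: AE_I2 Max_ge)
qed

text \<open>The \<open>j\<close>-th iterate is a function of the rows drawn in steps \<open>1, \<dots>, j\<close>, hence independent of the
  row drawn in step \<open>Suc j\<close>.\<close>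

lemma (in prob_space) expectation_indicator_rk_iterate:
  fixes B :: "real ^ 'n ^ 'm" and g :: "real ^ 'n \<Rightarrow> real"
  assumes ind: "indep_vars (\<lambda>_. count_space UNIV) idx {1..}"
  shows "(LINT \<omega>|M. indicator {\<omega> \<in> space M. idx (Suc j) \<omega> = i} \<omega>
             * g (rk_iterate B \<beta> x0 (\<lambda>l. idx l \<omega>) j))
       = prob {\<omega> \<in> space M. idx (Suc j) \<omega> = i}
             * (LINT \<omega>|M. g (rk_iterate B \<beta> x0 (\<lambda>l. idx l \<omega>) j))"
proof -
  let ?x = "\<lambda>\<omega>. rk_iterate B \<beta> x0 (\<lambda>l. idx l \<omega>) j"
  have meas: "idx l \<in> measurable M (count_space UNIV)" if "l \<ge> 1" for l
    using ind that by (auto simp: indep_vars_def2)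
  define past where "past = PiM {1..j} (\<lambda>_. count_space (UNIV :: 'm set))"
  define now where "now = PiM {Suc j} (\<lambda>_. count_space (UNIV :: 'm set))"
  define ind_i :: "(nat \<Rightarrow> 'm) \<Rightarrow> real" where "ind_i = (\<lambda>f. indicator {i} (f (Suc j)))"
  define val :: "(nat \<Rightarrow> 'm) \<Rightarrow> real" where "val = (\<lambda>f. g (rk_iterate B \<beta> x0 f j))"
  have indep: "indep_var now (\<lambda>\<omega>. restrict (\<lambda>l. idx l \<omega>) {Suc j})
                         past (\<lambda>\<omega>. restrict (\<lambda>l. idx l \<omega>) {1..j})"
    unfolding now_def past_def by (rule indep_var_restrict[OF ind]) auto
  have "simple_function past (\<lambda>f. rk_iterate B \<beta> x0 (\<lambda>l. f l) j)"
    unfolding past_def by (rule simple_function_rk_iterate) (auto intro: measurable_component_singleton)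
  then have val: "val \<in> borel_measurable past"
    unfolding val_def
    by (intro borel_measurable_simple_function) (auto intro: simple_function_compose1)
  have "(\<lambda>f. f (Suc j)) \<in> measurable now (count_space UNIV)"
    unfolding now_def by (auto intro: measurable_component_singleton)
  then have ind_i: "ind_i \<in> borel_measurable now"
    unfolding ind_i_def by (rule measurable_compose) simp
  have "indep_var borel (ind_i \<circ> (\<lambda>\<omega>. restrict (\<lambda>l. idx l \<omega>) {Suc j}))
                  borel (val \<circ> (\<lambda>\<omega>. restrict (\<lambda>l. idx l \<omega>) {1..j}))"
    using indep ind_i val by (rule indep_var_compose)
  moreover have "ind_i \<circ> (\<lambda>\<omega>. restrict (\<lambda>l. idx l \<omega>) {Suc j})
                 = (\<lambda>\<omega>. indicator {i} (idx (Suc j) \<omega>))"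
    by (auto simp: ind_i_def)
  moreover have "val \<circ> (\<lambda>\<omega>. restrict (\<lambda>l. idx l \<omega>) {1..j}) = (\<lambda>\<omega>. g (?x \<omega>))"
    unfolding val_def comp_def by (intro ext arg_cong[of _ _ g] rk_iterate_cong) simp
  ultimately have "indep_var borel (\<lambda>\<omega>. indicator {i} (idx (Suc j) \<omega>) :: real)
                             borel (\<lambda>\<omega>. g (?x \<omega>))" by simp
  moreover have "integrable M (\<lambda>\<omega>. g (?x \<omega>))"
    by (intro integrable_simple_function_compose simple_function_rk_iterate meas)
  moreover have "(\<lambda>\<omega>. indicator {i} (idx (Suc j) \<omega>) :: real) \<in> borel_measurable M"
    by (rule measurable_compose[OF meas]) auto
  then have "integrable M (\<lambda>\<omega>. indicator {i} (idx (Suc j) \<omega>) :: real)"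
    by (intro integrable_const_bound[of _ 1]) (auto simp: indicator_def)
  ultimately have "(LINT \<omega>|M. indicator {i} (idx (Suc j) \<omega>) * g (?x \<omega>))
      = (LINT \<omega>|M. indicator {i} (idx (Suc j) \<omega>)) * (LINT \<omega>|M. g (?x \<omega>))"
    by (intro indep_var_lebesgue_integral)
  moreover have "(LINT \<omega>|M. indicator {i} (idx (Suc j) \<omega>) * g (?x \<omega>))
      = (LINT \<omega>|M. indicator {\<omega> \<in> space M. idx (Suc j) \<omega> = i} \<omega> * g (?x \<omega>))"
    by (intro Bochner_Integration.integral_cong) (auto simp: indicator_def)
  moreover have "(LINT \<omega>|M. indicator {i} (idx (Suc j) \<omega>) :: real)
      = (LINT \<omega>|M. indicator {\<omega> \<in> space M. idx (Suc j) \<omega> = i} \<omega>)"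
    by (intro Bochner_Integration.integral_cong) (auto simp: indicator_def)
  moreover have "\<dots> = prob {\<omega> \<in> space M. idx (Suc j) \<omega> = i}"
    by (simp add: Int_absorb2)
  ultimately show ?thesis by simp
qed

text \<open>The expected squared error after a step, restricted to the event that the row drawn belongs to
  \<open>J\<close>.  Taking all rows gives the unconditional recursion; taking the rows with nonzero residual gives
  the localised form of the null space case.\<close>

lemma rk_expected_error:
  fixes B :: "real ^ 'n ^ 'm" and \<beta> :: "real ^ 'm" and x0 z :: "real ^ 'n"
  assumes sampling: "rk_sampling M B idx"
  defines "x \<equiv> \<lambda>j \<omega>. rk_iterate B \<beta> x0 (\<lambda>l. idx l \<omega>) j"
  shows "(LINT \<omega>:{\<omega> \<in> space M. idx (Suc j) \<omega> \<in> J}|M. (norm (x (Suc j) \<omega> - z))\<^sup>2)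
       = (LINT \<omega>:{\<omega> \<in> space M. idx (Suc j) \<omega> \<in> J}|M. (norm (x j \<omega> - z))\<^sup>2)
         + ((\<Sum>i | i \<in> J \<and> row i B \<noteq> 0. (row i B \<bullet> z - \<beta> $ i)\<^sup>2)
            - (LINT \<omega>|M. (\<Sum>i\<in>J. (row i B \<bullet> (x j \<omega> - z))\<^sup>2))) / (frobenius_norm B)\<^sup>2"
proof -
  interpret prob_space M using sampling by (simp add: rk_sampling_def)
  have ind: "indep_vars (\<lambda>_. count_space UNIV) idx {1..}"
    and pr: "\<And>i. prob {\<omega> \<in> space M. idx (Suc j) \<omega> = i} = (norm (row i B))\<^sup>2 / (frobenius_norm B)\<^sup>2"
    using sampling by (auto simp: rk_sampling_def)
  have meas: "idx l \<in> measurable M (count_space UNIV)" if "l \<ge> 1" for l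
    using ind that by (auto simp: indep_vars_def2)
  have simple: "simple_function M (x l)" for l
    unfolding x_def by (rule simple_function_rk_iterate) (rule meas)
  note int = integrable_simple_function_compose[OF simple]
  have ev [measurable]: "{\<omega> \<in> space M. idx (Suc j) \<omega> \<in> I} \<in> events" for I
    using measurable_sets[OF meas, of "Suc j" I] by (simp add: vimage_def Int_def conj_commute)
  have ev1: "{\<omega> \<in> space M. idx (Suc j) \<omega> = i} \<in> events" for i
    using ev[of "{i}"] by simp
  define E where "E = {\<omega> \<in> space M. idx (Suc j) \<omega> \<in> J}"
  define F where "F = (frobenius_norm B)\<^sup>2"
  define a where "a = (\<lambda>i. row i B)"
  define r where "r = (\<lambda>i. a i \<bullet> z - \<beta> $ i)"
  define h where "h = (\<lambda>i y. ((r i)\<^sup>2 - (a i \<bullet> (y - z))\<^sup>2) / (norm (a i))\<^sup>2)"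
  define D where "D = (\<lambda>i. {\<omega> \<in> space M. idx (Suc j) \<omega> = i})"
  have int_D: "integrable M (\<lambda>\<omega>. indicator (D i) \<omega> * h i (x j \<omega>))" for i
    using integrable_mult_indicator[OF ev1 int[of "h i"], of i] by (simp add: D_def)
  have int_E: "integrable M (\<lambda>\<omega>. indicator E \<omega> * (norm (x j \<omega> - z))\<^sup>2)"
    using integrable_mult_indicator[OF ev int[of "\<lambda>y. (norm (y - z))\<^sup>2"], of J] by (simp add: E_def)
  have pointwise: "indicator E \<omega> * (norm (x (Suc j) \<omega> - z))\<^sup>2
      = indicator E \<omega> * (norm (x j \<omega> - z))\<^sup>2 + (\<Sum>i\<in>J. indicator (D i) \<omega> * h i (x j \<omega>))"
    if "\<omega> \<in> space M" for \<omega>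
  proof -
    define i where "i = idx (Suc j) \<omega>"
    have "(norm (x (Suc j) \<omega> - z))\<^sup>2 = (norm (x j \<omega> - z))\<^sup>2 + h i (x j \<omega>)"
      by (simp add: x_def Let_def h_def r_def a_def i_def kaczmarz_step_error)
    moreover have "(\<Sum>i'\<in>J. indicator (D i') \<omega> * h i' (x j \<omega>))
        = (\<Sum>i'\<in>J. if i' = i then h i (x j \<omega>) else 0)"
      using that by (intro sum.cong) (auto simp: D_def i_def indicator_def)
    ultimately show ?thesis using that
      by (simp add: sum.delta E_def i_def indicator_def)
  qed
  have weighted: "(LINT \<omega>|M. indicator (D i) \<omega> * h i (x j \<omega>))
      = ((if a i \<noteq> 0 then (r i)\<^sup>2 else 0) - (LINT \<omega>|M. (a i \<bullet> (x j \<omega> - z))\<^sup>2)) / F" for i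
  proof -
    have "(LINT \<omega>|M. indicator (D i) \<omega> * h i (x j \<omega>))
        = (norm (a i))\<^sup>2 / F * (LINT \<omega>|M. h i (x j \<omega>))"
      unfolding D_def x_def a_def F_def
      by (subst expectation_indicator_rk_iterate[OF ind]) (simp add: pr)
    also have "(LINT \<omega>|M. h i (x j \<omega>))
        = ((r i)\<^sup>2 - (LINT \<omega>|M. (a i \<bullet> (x j \<omega> - z))\<^sup>2)) / (norm (a i))\<^sup>2"
      unfolding h_def using int[of "\<lambda>y. (a i \<bullet> (y - z))\<^sup>2"] by (simp add: prob_space)
    \<comment> \<open>For \<open>a\<^sub>i = 0\<close> the denominator does not cancel; the weight is then zero, and so is
      \<open>a\<^sub>i \<bullet> (x - z)\<close>, which leaves only the residual to be excluded on the right.\<close>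
    finally show ?thesis by (cases "a i = 0") auto
  qed
  have "(LINT \<omega>|M. indicator E \<omega> * (norm (x (Suc j) \<omega> - z))\<^sup>2)
      = (LINT \<omega>|M. indicator E \<omega> * (norm (x j \<omega> - z))\<^sup>2
                    + (\<Sum>i\<in>J. indicator (D i) \<omega> * h i (x j \<omega>)))"
    by (intro Bochner_Integration.integral_cong refl pointwise)
  also have "\<dots> = (LINT \<omega>|M. indicator E \<omega> * (norm (x j \<omega> - z))\<^sup>2)
      + (\<Sum>i\<in>J. LINT \<omega>|M. indicator (D i) \<omega> * h i (x j \<omega>))"
    by (simp only: Bochner_Integration.integral_add[OF int_E Bochner_Integration.integrable_sum]
        Bochner_Integration.integral_sum int_D)
  also have "(\<Sum>i\<in>J. LINT \<omega>|M. indicator (D i) \<omega> * h i (x j \<omega>))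
      = ((\<Sum>i\<in>J. if a i \<noteq> 0 then (r i)\<^sup>2 else 0)
          - (\<Sum>i\<in>J. LINT \<omega>|M. (a i \<bullet> (x j \<omega> - z))\<^sup>2)) / F"
    unfolding weighted by (simp only: sum_divide_distrib[symmetric] sum_subtractf)
  also have "(\<Sum>i\<in>J. if a i \<noteq> 0 then (r i)\<^sup>2 else 0) = (\<Sum>i | i \<in> J \<and> a i \<noteq> 0. (r i)\<^sup>2)"
    by (simp add: sum.If_cases Int_def conj_commute)
  also have "(\<Sum>i\<in>J. LINT \<omega>|M. (a i \<bullet> (x j \<omega> - z))\<^sup>2) = (LINT \<omega>|M. (\<Sum>i\<in>J. (a i \<bullet> (x j \<omega> - z))\<^sup>2))"
    by (rule Bochner_Integration.integral_sum[symmetric]) (rule int)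
  finally show ?thesis
    by (simp add: set_lebesgue_integral_def E_def F_def a_def r_def)
qed

section \<open>The expected error of the randomized Kaczmarz method\<close>

theorem theorem3p1:
  fixes A At :: "real ^ 'n ^ 'm" and b bt :: "real ^ 'm"
    and x0 x_LS :: "real ^ 'n"
    and M :: "'w measure" and idx :: "nat \<Rightarrow> 'w \<Rightarrow> 'm"
    and x e :: "nat \<Rightarrow> 'w \<Rightarrow> real ^ 'n" and k :: nat
  assumes sampling: "rk_sampling M At idx"
    and x_def: "\<And>j \<omega>. x j \<omega> = rk_iterate At bt x0 (\<lambda>l. idx l \<omega>) j"
    and x_LS_def: "x_LS = pseudoinverse A *v b"
    and e_def: "\<And>j \<omega>. e j \<omega> = x j \<omega> - x_LS"
    and k: "k \<ge> 1"
  shows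
    "((AE \<omega> in M. e (k - 1) \<omega> \<in> matrix_range (transpose At)) \<longrightarrow>
       (LINT \<omega>|M. (norm (e k \<omega>))\<^sup>2)
         \<le> (1 - (sigma_min At)\<^sup>2 / (frobenius_norm At)\<^sup>2) * (LINT \<omega>|M. (norm (e (k - 1) \<omega>))\<^sup>2)
            + (norm (At *v x_LS - bt))\<^sup>2 / (frobenius_norm At)\<^sup>2)
     \<and>
     ((AE \<omega> in M. e (k - 1) \<omega> \<in> matrix_null At) \<longrightarrow>
       ((\<forall>i. row i At = 0 \<longrightarrow> bt $ i = 0) \<longrightarrow>
         (LINT \<omega>|M. (norm (e k \<omega>))\<^sup>2)
           = (LINT \<omega>|M. (norm (e (k - 1) \<omega>))\<^sup>2)
              + (norm (At *v x_LS - bt))\<^sup>2 / (frobenius_norm At)\<^sup>2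
         \<and>
         (let E = {\<omega> \<in> space M. row (idx k \<omega>) At \<bullet> x_LS - bt $ idx k \<omega> \<noteq> 0}
          in (LINT \<omega>:E|M. (norm (e k \<omega>))\<^sup>2)
               = (LINT \<omega>:E|M. (norm (e (k - 1) \<omega>))\<^sup>2)
                  + (norm (At *v x_LS - bt))\<^sup>2 / (frobenius_norm At)\<^sup>2))
       \<and>
       (AE \<omega> in M. row (idx k \<omega>) At \<bullet> x_LS - bt $ idx k \<omega> = 0 \<longrightarrow> x k \<omega> = x (k - 1) \<omega>))
     \<and>
     (\<not> (AE \<omega> in M. e (k - 1) \<omega> \<in> matrix_range (transpose At)) \<and>
      \<not> (AE \<omega> in M. e (k - 1) \<omega> \<in> matrix_null At) \<longrightarrow>
       (let \<xi> = (LINT \<omega>|M. (norm (orth_proj (matrix_range (transpose At)) (x (k - 1) \<omega> - x_LS)))\<^sup>2)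
                 / (LINT \<omega>|M. (norm (x (k - 1) \<omega> - x_LS))\<^sup>2)
        in (LINT \<omega>|M. (norm (e k \<omega>))\<^sup>2)
             \<le> (1 - (sigma_min At)\<^sup>2 / (frobenius_norm At)\<^sup>2 * \<xi>)
                  * (LINT \<omega>|M. (norm (e (k - 1) \<omega>))\<^sup>2)
                + (norm (At *v x_LS - bt))\<^sup>2 / (frobenius_norm At)\<^sup>2
           \<and> \<xi> < 1))"
proof -
  interpret prob_space M using sampling by (simp add: rk_sampling_def)
  obtain j where kj: "k = Suc j" using k by (cases k) auto
  define V where "V = matrix_range (transpose At)"
  define F where "F = (frobenius_norm At)\<^sup>2"
  define S where "S = (sigma_min At)\<^sup>2"
  define r where "r = (\<lambda>i. row i At \<bullet> x_LS - bt $ i)"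
  have V: "subspace V" unfolding V_def by (rule subspace_matrix_range)
  have F0: "F \<ge> 0" by (simp add: F_def)
  have x_eq: "x = (\<lambda>j \<omega>. rk_iterate At bt x0 (\<lambda>l. idx l \<omega>) j)"
    using x_def by blast
  have "idx l \<in> measurable M (count_space UNIV)" if "l \<ge> 1" for l
    using sampling that by (auto simp: rk_sampling_def indep_vars_def2)
  then have simple: "simple_function M (e l)" for l
    unfolding e_def[abs_def] x_eq
    by (intro simple_function_compose1[of _ _ "\<lambda>y. y - x_LS"] simple_function_rk_iterate)
  note int = integrable_simple_function_compose[OF simple]
  have norm_r: "(norm (At *v x_LS - bt))\<^sup>2 = (\<Sum>i\<in>UNIV. (r i)\<^sup>2)"
    unfolding power2_norm_eq_inner inner_vec_def[of "At *v x_LS - bt"]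
    by (simp add: matrix_vector_mul_component row_def power2_eq_square vec_lambda_eta r_def)
  have local: "(LINT \<omega>:{\<omega> \<in> space M. idx k \<omega> \<in> J}|M. (norm (e k \<omega>))\<^sup>2)
       = (LINT \<omega>:{\<omega> \<in> space M. idx k \<omega> \<in> J}|M. (norm (e j \<omega>))\<^sup>2)
         + ((\<Sum>i | i \<in> J \<and> row i At \<noteq> 0. (r i)\<^sup>2)
            - (LINT \<omega>|M. (\<Sum>i\<in>J. (row i At \<bullet> e j \<omega>)\<^sup>2))) / F" for J
    using rk_expected_error[OF sampling, of j J bt x0 x_LS]
    by (simp add: kj x_eq e_def F_def r_def)
  have global: "(LINT \<omega>|M. (norm (e k \<omega>))\<^sup>2)
       = (LINT \<omega>|M. (norm (e j \<omega>))\<^sup>2)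
         + ((\<Sum>i | row i At \<noteq> 0. (r i)\<^sup>2) - (LINT \<omega>|M. (norm (At *v e j \<omega>))\<^sup>2)) / F"
    using local[of UNIV] int[of "\<lambda>y. (norm y)\<^sup>2"]
    by (simp add: set_integral_space sum_row_inner_squared)

  \<comment> \<open>Both contraction estimates are instances of one bound in terms of the projected error.\<close>
  have contraction: "(LINT \<omega>|M. (norm (e k \<omega>))\<^sup>2)
      \<le> (LINT \<omega>|M. (norm (e j \<omega>))\<^sup>2) - S / F * (LINT \<omega>|M. (norm (orth_proj V (e j \<omega>)))\<^sup>2)
         + (norm (At *v x_LS - bt))\<^sup>2 / F"
  proof -
    have "S * (LINT \<omega>|M. (norm (orth_proj V (e j \<omega>)))\<^sup>2)
        = (LINT \<omega>|M. S * (norm (orth_proj V (e j \<omega>)))\<^sup>2)" by simp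
    also have "\<dots> \<le> (LINT \<omega>|M. (norm (At *v e j \<omega>))\<^sup>2)"
      using int[of "\<lambda>y. S * (norm (orth_proj V y))\<^sup>2"] int[of "\<lambda>y. (norm (At *v y))\<^sup>2"]
      unfolding S_def V_def
      by (intro integral_mono norm_matrix_ge_sigma_min_orth_proj)
    finally have "S * (LINT \<omega>|M. (norm (orth_proj V (e j \<omega>)))\<^sup>2)
        \<le> (LINT \<omega>|M. (norm (At *v e j \<omega>))\<^sup>2)" .
    moreover have "(\<Sum>i | row i At \<noteq> 0. (r i)\<^sup>2) \<le> (norm (At *v x_LS - bt))\<^sup>2"
      unfolding norm_r by (intro sum_mono2) auto
    ultimately have "((\<Sum>i | row i At \<noteq> 0. (r i)\<^sup>2) - (LINT \<omega>|M. (norm (At *v e j \<omega>))\<^sup>2)) / F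
        \<le> ((norm (At *v x_LS - bt))\<^sup>2 - S * (LINT \<omega>|M. (norm (orth_proj V (e j \<omega>)))\<^sup>2)) / F"
      using F0 by (intro divide_right_mono) auto
    then show ?thesis unfolding global by (simp add: diff_divide_distrib)
  qed

  have range_case: "(LINT \<omega>|M. (norm (e k \<omega>))\<^sup>2)
         \<le> (1 - S / F) * (LINT \<omega>|M. (norm (e j \<omega>))\<^sup>2) + (norm (At *v x_LS - bt))\<^sup>2 / F"
    if "AE \<omega> in M. e j \<omega> \<in> V"
  proof -
    have "(LINT \<omega>|M. (norm (orth_proj V (e j \<omega>)))\<^sup>2) = (LINT \<omega>|M. (norm (e j \<omega>))\<^sup>2)"
      using that
      by (intro integral_cong_AE borel_measurable_integrable int) (auto simp: orth_proj_of_mem[OF V])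
    then show ?thesis using contraction by (simp add: left_diff_distrib)
  qed

  have null_case:
    "((\<forall>i. row i At = 0 \<longrightarrow> bt $ i = 0) \<longrightarrow>
         (LINT \<omega>|M. (norm (e k \<omega>))\<^sup>2)
           = (LINT \<omega>|M. (norm (e j \<omega>))\<^sup>2) + (norm (At *v x_LS - bt))\<^sup>2 / F
         \<and>
         (let E = {\<omega> \<in> space M. r (idx k \<omega>) \<noteq> 0}
          in (LINT \<omega>:E|M. (norm (e k \<omega>))\<^sup>2)
               = (LINT \<omega>:E|M. (norm (e j \<omega>))\<^sup>2) + (norm (At *v x_LS - bt))\<^sup>2 / F))
       \<and> (AE \<omega> in M. r (idx k \<omega>) = 0 \<longrightarrow> x k \<omega> = x j \<omega>)"
    if null: "AE \<omega> in M. e j \<omega> \<in> matrix_null At"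
  proof (intro conjI impI)
    have orth: "row i At \<bullet> v = 0" if "v \<in> matrix_null At" for i v
    proof -
      have "(\<Sum>i\<in>UNIV. (row i At \<bullet> v)\<^sup>2) = 0"
        using that by (simp add: sum_row_inner_squared matrix_null_def)
      then show ?thesis by (simp add: sum_nonneg_eq_0_iff)
    qed
    have zero: "(LINT \<omega>|M. (\<Sum>i\<in>J. (row i At \<bullet> e j \<omega>)\<^sup>2)) = 0" for J
      by (rule integral_eq_zero_AE) (use null in \<open>auto simp: orth\<close>)
    show "AE \<omega> in M. r (idx k \<omega>) = 0 \<longrightarrow> x k \<omega> = x j \<omega>"
      using null
    proof eventually_elim
      case (elim \<omega>)
      have "row (idx k \<omega>) At \<bullet> x j \<omega> = row (idx k \<omega>) At \<bullet> x_LS"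
        using orth[OF elim] by (simp add: e_def inner_diff_right)
      then show ?case by (simp add: r_def kj x_def Let_def)
    qed
    assume "\<forall>i. row i At = 0 \<longrightarrow> bt $ i = 0"
    \<comment> \<open>Rows that are never drawn have zero residual, so no residual is lost.\<close>
    then have r0: "row i At \<noteq> 0" if "r i \<noteq> 0" for i
      using that by (auto simp: r_def)
    have residual: "(\<Sum>i | i \<in> J \<and> row i At \<noteq> 0. (r i)\<^sup>2) = (norm (At *v x_LS - bt))\<^sup>2"
      if "{i. r i \<noteq> 0} \<subseteq> J" for J
      unfolding norm_r using that r0 by (intro sum.mono_neutral_left) auto
    show "(LINT \<omega>|M. (norm (e k \<omega>))\<^sup>2)
           = (LINT \<omega>|M. (norm (e j \<omega>))\<^sup>2) + (norm (At *v x_LS - bt))\<^sup>2 / F"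
      using global residual[of UNIV] zero[of UNIV] by (simp add: sum_row_inner_squared)
    show "let E = {\<omega> \<in> space M. r (idx k \<omega>) \<noteq> 0}
          in (LINT \<omega>:E|M. (norm (e k \<omega>))\<^sup>2)
               = (LINT \<omega>:E|M. (norm (e j \<omega>))\<^sup>2) + (norm (At *v x_LS - bt))\<^sup>2 / F"
      using local[of "{i. r i \<noteq> 0}"] residual[of "{i. r i \<noteq> 0}"] zero by (simp add: Let_def)
  qed

  have general_case:
    "(LINT \<omega>|M. (norm (e k \<omega>))\<^sup>2)
        \<le> (1 - S / F * \<xi>) * (LINT \<omega>|M. (norm (e j \<omega>))\<^sup>2) + (norm (At *v x_LS - bt))\<^sup>2 / F \<and> \<xi> < 1"
    if not_range: "\<not> (AE \<omega> in M. e j \<omega> \<in> V)"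
      and \<xi>: "\<xi> = (LINT \<omega>|M. (norm (orth_proj V (e j \<omega>)))\<^sup>2) / (LINT \<omega>|M. (norm (e j \<omega>))\<^sup>2)" for \<xi>
  proof -
    let ?P = "LINT \<omega>|M. (norm (orth_proj V (e j \<omega>)))\<^sup>2"
    let ?N = "LINT \<omega>|M. (norm (e j \<omega>))\<^sup>2"
    let ?R = "LINT \<omega>|M. (norm (e j \<omega> - orth_proj V (e j \<omega>)))\<^sup>2"
    note int_P = int[of "\<lambda>y. (norm (orth_proj V y))\<^sup>2"]
    note int_R = int[of "\<lambda>y. (norm (y - orth_proj V y))\<^sup>2"]
    have "?N = (LINT \<omega>|M. (norm (orth_proj V (e j \<omega>)))\<^sup>2 + (norm (e j \<omega> - orth_proj V (e j \<omega>)))\<^sup>2)"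
      by (subst norm_orth_proj_pythagoras[OF V]) (rule refl)
    also have "\<dots> = ?P + ?R" using int_P int_R by (rule Bochner_Integration.integral_add)
    finally have split: "?N = ?P + ?R" .
    have "?R \<noteq> 0"
    proof
      assume "?R = 0"
      then have "AE \<omega> in M. (norm (e j \<omega> - orth_proj V (e j \<omega>)))\<^sup>2 = 0"
        using integral_nonneg_eq_0_iff_AE[OF int_R] by simp
      then have "AE \<omega> in M. e j \<omega> \<in> V"
      proof eventually_elim
        case (elim \<omega>)
        then show ?case using orth_proj_characterization(1)[OF V, of "e j \<omega>"] by simp
      qed
      then show False using not_range by blast
    qed
    moreover have "?R \<ge> 0" "?P \<ge> 0" by simp_all
    ultimately have "?P < ?N" "?N > 0" using split by linarith+
    then have "\<xi> < 1" "\<xi> * ?N = ?P" unfolding \<xi> by simp_all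
    then show ?thesis using contraction by (simp add: left_diff_distrib mult.assoc)
  qed

  show ?thesis
    using range_case null_case general_case
    unfolding kj diff_Suc_1 V_def S_def F_def r_def e_def[symmetric] Let_def by blast
qed

end
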